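(* Let $\alpha$ be a unit speed curve in the Lie group $SO(3)$, with a bi-invariant metric $\langle\,,\rangle$ for which $\tau_G=\frac12$, with Frenet frame $\{T,N,B\}$, curvature $\varkappa$ and torsion $\tau$. Then $\alpha$ is a slant helix if and only if $$\sigma_N=\frac{\left(\varkappa^2+(\tau-\frac12)^2\right)^{3/2}}{\varkappa^2\left(\frac{\tau-\frac12}{\varkappa}\right)'}$$ is a constant function (which includes that $\left(\frac{\tau-1/2}{\varkappa}\right)'$ vanishes nowhere, so that the quotient is defined).
   Context: $G=SO(3)$ (written $SO^3$ in the paper), $\mathfrak{g}$ is its Lie algebra of left-invariant vector fields and $D$ is the Levi-Civita connection, so $D_XY=\frac12[X,Y]$ for $X,Y\in\mathfrak{g}$. Let $\{X_1,X_2,X_3\}$ be an orthonormal basis of $\mathfrak{g}$. Vector fields along $\alpha$ are written $W=\sum_i w_iX_i$ with smooth $w_i$; one sets $\dot W=\sum_i w_i'X_i$, brackets are extended bilinearly over functions, and $D_{\alpha'}W=\dot W+\frac12[T,W]$ with $T=\alpha'$. The Frenet apparatus of a unit speed curve consists of the positively oriented orthonormal frame $T=\alpha',N,B=T\times N$, the curvature $\varkappa=\|\dot T\|>0$ and the torsion $\tau$, with $D_TT=\varkappa N$, $D_TN=-\varkappa T+\tau B$, $D_TB=-\tau N$. One sets $\tau_G=\frac12\langle[T,N],B\rangle$; the metric and orientation on $SO(3)$ are normalized so that $\tau_G=\frac12$ for every such curve (i.e. $[X_1,X_2]=X_3$ and cyclically, for a positively oriented orthonormal basis of $\mathfrak{g}$).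 Prime denotes differentiation with respect to the arc length $s$. Slant helix: $\alpha$ is a slant helix if there is a unit length left-invariant vector field $X\in\mathfrak{g}$ and a constant angle $\theta\ne\frac{\pi}{2}$ such that $\langle N(s),X\rangle=\cos\theta$ for all $s$. *)

theory Defs
  imports "HOL-Analysis.Analysis"
begin

type_synonym mat3 = "real ^ 3 ^ 3"

type_synonym vfield = "mat3 \<Rightarrow> mat3"

type_synonym metric3 = "mat3 \<Rightarrow> mat3 \<Rightarrow> mat3 \<Rightarrow> real"

definition SO3 :: "mat3 set" where
  "SO3 = {p. rotation_matrix p}"

text \<open>The tangent space at \<open>p\<close> is the left translate of the space of skew-symmetric matrices,
  which is the tangent space at the identity.\<close>

definition tangent_SO3 :: "mat3 \<Rightarrow> mat3 set" where
  "tangent_SO3 p = {p ** A | A. transpose A = - A}"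

text \<open>Elements of the Lie algebra are vector fields on SO(3); only their values on SO(3) matter.\<close>

definition left_invariant :: "vfield \<Rightarrow> bool" where
  "left_invariant X \<longleftrightarrow>
     (\<forall>p\<in>SO3. X p \<in> tangent_SO3 p) \<and> (\<forall>h\<in>SO3. \<forall>p\<in>SO3. X (h ** p) = h ** X p)"

text \<open>For left-invariant fields \<open>p \<mapsto> p ** A\<close> and \<open>p \<mapsto> p ** C\<close> on a matrix group the Lie bracket
  is \<open>p \<mapsto> p ** (A ** C - C ** A)\<close>; \<open>A\<close> and \<open>C\<close> are the values at the identity.\<close>

definition lie_bracket :: "vfield \<Rightarrow> vfield \<Rightarrow> vfield" where
  "lie_bracket X Y p = p ** (X (mat 1) ** Y (mat 1) - Y (mat 1) ** X (mat 1))"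

text \<open>In \<open>m p u v\<close> the vectors \<open>u\<close> and \<open>v\<close> are tangent at \<open>p\<close>. Smooth dependence on \<open>p\<close>
  is not required here because invariance forces it.\<close>

definition inner_product_on_tangent :: "metric3 \<Rightarrow> mat3 \<Rightarrow> bool" where
  "inner_product_on_tangent m p \<longleftrightarrow>
     (\<forall>u\<in>tangent_SO3 p. \<forall>v\<in>tangent_SO3 p. \<forall>w\<in>tangent_SO3 p. \<forall>a b.
        m p (a *\<^sub>R u + b *\<^sub>R v) w = a * m p u w + b * m p v w) \<and>
     (\<forall>u\<in>tangent_SO3 p. \<forall>v\<in>tangent_SO3 p. m p u v = m p v u) \<and>
     (\<forall>u\<in>tangent_SO3 p. u \<noteq> 0 \<longrightarrow> m p u u > 0)"

definition bi_invariant_metric :: "metric3 \<Rightarrow> bool" where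
  "bi_invariant_metric m \<longleftrightarrow>
     (\<forall>p\<in>SO3. inner_product_on_tangent m p) \<and>
     (\<forall>h\<in>SO3. \<forall>p\<in>SO3. \<forall>u\<in>tangent_SO3 p. \<forall>v\<in>tangent_SO3 p.
        m (h ** p) (h ** u) (h ** v) = m p u v \<and> m (p ** h) (u ** h) (v ** h) = m p u v)"

text \<open>An orthonormal triple of left-invariant fields is a basis because the Lie algebra has
  dimension three. The ordered basis \<open>X 1, X 2, X 3\<close> also fixes the orientation of SO(3): it is
  positively oriented by convention.\<close>

definition orthonormal_basis :: "metric3 \<Rightarrow> (3 \<Rightarrow> vfield) \<Rightarrow> bool" where
  "orthonormal_basis m X \<longleftrightarrow>
     (\<forall>i. left_invariant (X i)) \<and>
     (\<forall>p\<in>SO3. \<forall>i j. m p (X i p) (X j p) = (if i = j then 1 else 0))"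

text \<open>A vector field along \<open>\<alpha>\<close> is \<open>W = (\<Sum>i. w i * X i)\<close> with coefficients
  \<open>w i = \<langle>W, X i\<rangle>\<close>.\<close>

definition coeff :: "metric3 \<Rightarrow> (3 \<Rightarrow> vfield) \<Rightarrow> (real \<Rightarrow> mat3) \<Rightarrow> (real \<Rightarrow> mat3) \<Rightarrow> 3 \<Rightarrow> real \<Rightarrow> real" where
  "coeff m X \<alpha> W i s = m (\<alpha> s) (W s) (X i (\<alpha> s))"

definition dot_along :: "metric3 \<Rightarrow> (3 \<Rightarrow> vfield) \<Rightarrow> (real \<Rightarrow> mat3) \<Rightarrow> (real \<Rightarrow> mat3) \<Rightarrow> real \<Rightarrow> mat3" where
  "dot_along m X \<alpha> W s = (\<Sum>i\<in>UNIV. deriv (coeff m X \<alpha> W i) s *\<^sub>R X i (\<alpha> s))"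

definition bracket_along ::
    "metric3 \<Rightarrow> (3 \<Rightarrow> vfield) \<Rightarrow> (real \<Rightarrow> mat3) \<Rightarrow> (real \<Rightarrow> mat3) \<Rightarrow> (real \<Rightarrow> mat3) \<Rightarrow> real \<Rightarrow> mat3" where
  "bracket_along m X \<alpha> V W s =
     (\<Sum>i\<in>UNIV. \<Sum>j\<in>UNIV.
        (coeff m X \<alpha> V i s * coeff m X \<alpha> W j s) *\<^sub>R lie_bracket (X i) (X j) (\<alpha> s))"

definition cross_along ::
    "metric3 \<Rightarrow> (3 \<Rightarrow> vfield) \<Rightarrow> (real \<Rightarrow> mat3) \<Rightarrow> (real \<Rightarrow> mat3) \<Rightarrow> (real \<Rightarrow> mat3) \<Rightarrow> real \<Rightarrow> mat3" where
  "cross_along m X \<alpha> V W s =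
     (\<Sum>i\<in>UNIV. (cross3 (\<chi> j. coeff m X \<alpha> V j s) (\<chi> j. coeff m X \<alpha> W j s) $ i) *\<^sub>R X i (\<alpha> s))"

definition velocity :: "(real \<Rightarrow> mat3) \<Rightarrow> real \<Rightarrow> mat3" where
  "velocity \<alpha> s = vector_derivative \<alpha> (at s)"

text \<open>The Levi-Civita connection of a bi-invariant metric, \<open>D X Y = 1/2 [X, Y]\<close> on
  left-invariant fields, induces this covariant derivative along \<open>\<alpha>\<close>.\<close>

definition cov_deriv ::
    "metric3 \<Rightarrow> (3 \<Rightarrow> vfield) \<Rightarrow> (real \<Rightarrow> mat3) \<Rightarrow> (real \<Rightarrow> mat3) \<Rightarrow> real \<Rightarrow> mat3" where
  "cov_deriv m X \<alpha> W s =
     dot_along m X \<alpha> W s + (1/2) *\<^sub>R bracket_along m X \<alpha> (velocity \<alpha>) W s"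

text \<open>Derivatives of all orders exist on \<open>I\<close> (used for open \<open>I\<close>); \<open>F n\<close> is the \<open>n\<close>-th one.\<close>

definition smooth_curve_on :: "real set \<Rightarrow> (real \<Rightarrow> 'a::real_normed_vector) \<Rightarrow> bool" where
  "smooth_curve_on I f \<longleftrightarrow>
     (\<exists>F. F 0 = f \<and> (\<forall>n. \<forall>s\<in>I. (F n has_vector_derivative F (Suc n) s) (at s)))"

definition unit_speed_curve :: "metric3 \<Rightarrow> real set \<Rightarrow> (real \<Rightarrow> mat3) \<Rightarrow> bool" where
  "unit_speed_curve m I \<alpha> \<longleftrightarrow>
     I \<noteq> {} \<and> open I \<and> is_interval I \<and> \<alpha> ` I \<subseteq> SO3 \<and> smooth_curve_on I \<alpha> \<and>
     (\<forall>s\<in>I. m (\<alpha> s) (velocity \<alpha> s) (velocity \<alpha> s) = 1)"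

definition frenet_curve ::
    "metric3 \<Rightarrow> (3 \<Rightarrow> vfield) \<Rightarrow> real set \<Rightarrow> (real \<Rightarrow> mat3) \<Rightarrow>
     (real \<Rightarrow> mat3) \<Rightarrow> (real \<Rightarrow> mat3) \<Rightarrow> (real \<Rightarrow> mat3) \<Rightarrow> (real \<Rightarrow> real) \<Rightarrow> (real \<Rightarrow> real) \<Rightarrow> bool" where
  "frenet_curve m X I \<alpha> T N B \<kappa> \<tau> \<longleftrightarrow>
     unit_speed_curve m I \<alpha> \<and>
     (\<forall>s\<in>I.
        T s = velocity \<alpha> s \<and>
        m (\<alpha> s) (T s) (N s) = 0 \<and> m (\<alpha> s) (N s) (N s) = 1 \<and>
        B s = cross_along m X \<alpha> T N s \<and>
        \<kappa> s = sqrt (m (\<alpha> s) (dot_along m X \<alpha> T s) (dot_along m X \<alpha> T s)) \<and> \<kappa> s > 0 \<and>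
        cov_deriv m X \<alpha> T s = \<kappa> s *\<^sub>R N s \<and>
        cov_deriv m X \<alpha> N s = - \<kappa> s *\<^sub>R T s + \<tau> s *\<^sub>R B s \<and>
        cov_deriv m X \<alpha> B s = - \<tau> s *\<^sub>R N s)"

definition tau_G ::
    "metric3 \<Rightarrow> (3 \<Rightarrow> vfield) \<Rightarrow> (real \<Rightarrow> mat3) \<Rightarrow>
     (real \<Rightarrow> mat3) \<Rightarrow> (real \<Rightarrow> mat3) \<Rightarrow> (real \<Rightarrow> mat3) \<Rightarrow> real \<Rightarrow> real" where
  "tau_G m X \<alpha> T N B s = 1/2 * m (\<alpha> s) (bracket_along m X \<alpha> T N s) (B s)"

text \<open>Metric and orientation are normalized by \<open>\<tau>\<^sub>G = 1/2\<close>, that is,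
  \<open>[X 1, X 2] = X 3\<close> and cyclically.\<close>

definition tau_G_normalized :: "metric3 \<Rightarrow> (3 \<Rightarrow> vfield) \<Rightarrow> bool" where
  "tau_G_normalized m X \<longleftrightarrow>
     (\<forall>I \<alpha> T N B \<kappa> \<tau>. frenet_curve m X I \<alpha> T N B \<kappa> \<tau> \<longrightarrow> (\<forall>s\<in>I. tau_G m X \<alpha> T N B s = 1/2))"

text \<open>An angle lies in \<open>{0..pi}\<close>; without this bound, \<open>\<theta> \<noteq> pi/2\<close> would not exclude
  \<open>cos \<theta> = 0\<close>.\<close>

definition slant_helix :: "metric3 \<Rightarrow> real set \<Rightarrow> (real \<Rightarrow> mat3) \<Rightarrow> (real \<Rightarrow> mat3) \<Rightarrow> bool" where
  "slant_helix m I \<alpha> N \<longleftrightarrow>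
     (\<exists>X \<theta>. left_invariant X \<and> (\<forall>p\<in>SO3. m p (X p) (X p) = 1) \<and>
        \<theta> \<in> {0..pi} \<and> \<theta> \<noteq> pi/2 \<and> (\<forall>s\<in>I. m (\<alpha> s) (N s) (X (\<alpha> s)) = cos \<theta>))"

definition sigma_N :: "(real \<Rightarrow> real) \<Rightarrow> (real \<Rightarrow> real) \<Rightarrow> real \<Rightarrow> real" where
  "sigma_N \<kappa> \<tau> s =
     ((\<kappa> s)\<^sup>2 + (\<tau> s - 1/2)\<^sup>2) powr (3/2) / ((\<kappa> s)\<^sup>2 * deriv (\<lambda>t. (\<tau> t - 1/2) / \<kappa> t) s)"

end

theory Submission
  imports Defs
begin

text \<open>
  The idea is to turn the statement into one about curves in Euclidean three-space. The hat map
  identifies skew-symmetric matrices with vectors so that the commutator becomes the cross product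
  and conjugation by a rotation becomes the rotation itself. Since rotations act transitively on
  each sphere, a bi-invariant metric is a multiple of the Euclidean inner product. An orthonormal
  basis \<open>X 1, X 2, X 3\<close> of the Lie algebra is therefore a scaled orthonormal basis of three-space,
  and in coordinates with respect to it the Lie bracket is \<open>c\<close> times the cross product for one
  constant \<open>c\<close> (\<open>orthonormal_basis_left_frame\<close>). The normalization \<open>\<tau>\<^sub>G = 1/2\<close>, evaluated on the
  given curve, forces \<open>c = 1\<close>.

  In these coordinates the Levi-Civita connection along \<open>\<alpha>\<close> differs from coordinatewise
  differentiation by half the cross product with the tangent, so the Frenet equations become
  \<open>t' = \<kappa> n\<close>, \<open>n' = - \<kappa> t + (\<tau> - 1/2) b\<close>, \<open>b' = - (\<tau> - 1/2) n\<close>: the Euclidean equations with the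
  torsion lowered by \<open>1/2\<close> (\<open>frenet_curve_moving_frame\<close>). Left-invariant fields are the fields with
  constant coordinates. A slant helix is thus a curve whose principal normal \<open>n\<close> has a constant
  nonzero inner product with a fixed unit vector (\<open>slant_helix_iff_constant_inner\<close>).

  What is left is the classical theorem on Euclidean slant helices. Put \<open>h = (\<tau> - 1/2) / \<kappa>\<close>,
  so that \<open>\<sigma>\<^sub>N = \<kappa> (1 + h\<^sup>2) powr (3/2) / h'\<close>. If \<open>x\<close> is a fixed vector with \<open>n \<bullet> x = a\<close> constant,
  then differentiating this equation twice gives \<open>t \<bullet> x = h (b \<bullet> x)\<close> and
  \<open>h' (b \<bullet> x) = a \<kappa> (1 + h\<^sup>2)\<close>. Hence \<open>(b \<bullet> x) sqrt (1 + h\<^sup>2)\<close> equals \<open>a \<sigma>\<^sub>N\<close>, and its derivative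
  turns out to be zero. Conversely, reading these relations backwards yields
  the components of a vector along the curve, which is constant as soon as \<open>\<sigma>\<^sub>N\<close> is.
\<close>

unbundle cross3_syntax

section \<open>Skew-symmetric matrices as vectors\<close>

definition hat :: "real ^ 3 \<Rightarrow> mat3" where
  "hat v = matrix (\<lambda>x. v \<times> x)"

definition vee :: "mat3 \<Rightarrow> real ^ 3" where
  "vee A = vector [A $ 3 $ 2, A $ 1 $ 3, A $ 2 $ 1]"

lemma hat_mult_vector: "hat v *v x = v \<times> x"
  by (simp add: hat_def matrix_works bilinear_cross[unfolded bilinear_def])

lemma vee_hat: "vee (hat v) = v"
  by (simp add: vee_def hat_def matrix_def vec_eq_iff forall_3 cross3_def axis_def)

lemma transpose_hat: "transpose (hat v) = - hat v"
  by (simp add: hat_def matrix_def transpose_def vec_eq_iff forall_3 cross3_def axis_def)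

lemma hat_vee:
  assumes "transpose A = - A"
  shows "hat (vee A) = A"
proof -
  have skew: "A $ j $ i = - A $ i $ j" for i j
    using arg_cong[OF assms, of "\<lambda>M. M $ i $ j"] by (simp add: transpose_def)
  have "A $ i $ i = 0" for i
    using skew[of i i] by simp
  then show ?thesis
    by (simp add: vee_def hat_def matrix_def vec_eq_iff forall_3 cross3_def axis_def
        skew[of 2 1] skew[of 1 3] skew[of 3 2])
qed

lemma linear_hat: "linear hat"
  by (rule linearI) (simp_all add: matrix_eq hat_mult_vector cross_add_left cross_mult_left
      matrix_vector_mult_add_rdistrib scaleR_matrix_vector_assoc[symmetric])

lemma linear_vee: "linear vee"
  by (rule linearI) (simp_all add: vee_def vec_eq_iff forall_3)

text \<open>This is the Jacobi identity for the cross product.\<close>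

lemma hat_cross: "hat u ** hat v - hat v ** hat u = hat (u \<times> v)"
proof -
  have "u \<times> (v \<times> x) - v \<times> (u \<times> x) = (u \<times> v) \<times> x" for x
    using Jacobi[of u v x] cross_skew[of x u] cross_skew[of x "u \<times> v"]
    by (simp add: algebra_simps)
  then show ?thesis
    by (simp add: matrix_eq matrix_vector_mult_diff_rdistrib hat_mult_vector
        flip: matrix_vector_mul_assoc)
qed

lemma SO3_orthogonal: "p \<in> SO3 \<Longrightarrow> transpose p ** p = mat 1" "p \<in> SO3 \<Longrightarrow> p ** transpose p = mat 1"
  by (simp_all add: SO3_def rotation_matrix_def orthogonal_matrix_def)

lemma mat_1_in_SO3: "mat 1 \<in> SO3"
  by (simp add: SO3_def rotation_matrix_def orthogonal_matrix_def transpose_mat)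

text \<open>Rotations preserve the cross product, so conjugating \<open>hat v\<close> by \<open>p\<close> rotates \<open>v\<close>.\<close>

lemma hat_rotate:
  assumes "p \<in> SO3"
  shows "p ** hat v = hat (p *v v) ** p"
  using assms cross_rotation_matrix[of p v]
  by (simp add: matrix_eq hat_mult_vector SO3_def flip: matrix_vector_mul_assoc)

lemma tangent_SO3_iff: "u \<in> tangent_SO3 p \<longleftrightarrow> (\<exists>v. u = p ** hat v)"
proof
  assume "u \<in> tangent_SO3 p"
  then obtain A where "u = p ** A" "transpose A = - A"
    by (auto simp: tangent_SO3_def)
  then show "\<exists>v. u = p ** hat v"
    by (intro exI[of _ "vee A"]) (simp only: hat_vee)
next
  assume "\<exists>v. u = p ** hat v"
  then show "u \<in> tangent_SO3 p"
    unfolding tangent_SO3_def using transpose_hat by blast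
qed

lemma left_invariant_value:
  assumes "left_invariant Y" "p \<in> SO3"
  shows "Y p = p ** hat (vee (Y (mat 1)))"
proof -
  have "Y (mat 1) \<in> tangent_SO3 (mat 1)"
    using assms(1) mat_1_in_SO3 by (simp add: left_invariant_def)
  then have "hat (vee (Y (mat 1))) = Y (mat 1)"
    by (auto simp: tangent_SO3_iff vee_hat)
  moreover have "Y (p ** mat 1) = p ** Y (mat 1)"
    using assms mat_1_in_SO3 unfolding left_invariant_def by blast
  ultimately show ?thesis by simp
qed

lemma left_invariant_translate: "left_invariant (\<lambda>p. p ** hat v)"
  by (auto simp: left_invariant_def tangent_SO3_iff matrix_mul_assoc)

section \<open>Bi-invariant metrics and orthonormal left-invariant frames\<close>

text \<open>Left invariance reduces the metric to its value \<open>g\<close> at the identity. Comparing left with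
  right invariance shows that \<open>g\<close> is invariant under conjugation, which acts on three-space by
  rotations. These carry any vector to any other of the same length, so \<open>g u u\<close> depends on the
  length of \<open>u\<close> alone; polarization does the rest.\<close>

lemma bi_invariant_metric_scalar:
  assumes "bi_invariant_metric m"
  obtains l where "l > 0"
    "\<And>p u v. p \<in> SO3 \<Longrightarrow> m p (p ** hat u) (p ** hat v) = l * (u \<bullet> v)"
proof -
  define g where "g u v = m (mat 1) (hat u) (hat v)" for u v
  have ip: "inner_product_on_tangent m (mat 1)"
    using assms mat_1_in_SO3 by (simp add: bi_invariant_metric_def)
  have tan1: "hat u \<in> tangent_SO3 (mat 1)" for u
    by (auto simp: tangent_SO3_iff)
  have comb: "g (a *\<^sub>R u + b *\<^sub>R v) w = a * g u w + b * g v w" for a b u v w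
    using ip tan1 unfolding inner_product_on_tangent_def g_def
    by (simp add: linear_add[OF linear_hat] linear_scale[OF linear_hat])
  have sym: "g u v = g v u" for u v
    using ip tan1 unfolding inner_product_on_tangent_def g_def by blast
  have pos: "g u u > 0" if "u \<noteq> 0" for u
  proof -
    have "hat u \<noteq> 0"
      using that vee_hat[of u] linear_0[OF linear_vee] by metis
    then show ?thesis
      using ip tan1 unfolding inner_product_on_tangent_def g_def by blast
  qed
  have left: "m p (p ** hat u) (p ** hat v) = g u v" if "p \<in> SO3" for p u v
    using assms that mat_1_in_SO3 tan1 unfolding bi_invariant_metric_def g_def
    by (metis matrix_mul_rid)
  have right: "m p (hat u ** p) (hat v ** p) = g u v" if "p \<in> SO3" for p u v
    using assms that mat_1_in_SO3 tan1 unfolding bi_invariant_metric_def g_def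
    by (metis matrix_mul_lid)
  have rot: "g (p *v u) (p *v v) = g u v" if "p \<in> SO3" for p u v
    using left[OF that] right[OF that] by (simp add: hat_rotate[OF that])
  define l where "l = g (axis 1 1) (axis 1 1)"
  have quad: "g u u = l * (u \<bullet> u)" for u
  proof -
    have "norm (norm u *\<^sub>R axis 1 1 :: real^3) = norm u"
      by simp
    then obtain f :: "real^3 \<Rightarrow> real^3" where f: "orthogonal_transformation f" "det (matrix f) = 1"
      "f (norm u *\<^sub>R axis 1 1) = u"
      using rotation_exists[of "norm u *\<^sub>R axis 1 1 :: real^3" u] by auto
    have "matrix f \<in> SO3"
      using f by (simp add: SO3_def rotation_matrix_def orthogonal_transformation_matrix)
    moreover have "matrix f *v x = f x" for x
      using f(1) by (simp add: matrix_works orthogonal_transformation_linear)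
    ultimately have "g u u = g (norm u *\<^sub>R axis 1 1) (norm u *\<^sub>R axis 1 1)"
      using f(3) rot by metis
    also have "\<dots> = norm u * norm u * l"
      using comb[of "norm u" "axis 1 1" 0 0] sym by (simp add: l_def)
    finally show ?thesis
      by (simp add: power2_norm_eq_inner flip: power2_eq_square)
  qed
  have "g u v = l * (u \<bullet> v)" for u v
  proof -
    have "g (u + v) (u + v) = g u u + 2 * g u v + g v v"
      using comb[of 1 u 1 v] sym[of _ "u + v"] sym[of v u] by simp
    then have "l * ((u + v) \<bullet> (u + v)) = l * (u \<bullet> u) + 2 * g u v + l * (v \<bullet> v)"
      by (simp only: quad)
    then show ?thesis
      by (simp add: inner_add_left inner_add_right inner_commute[of v u] algebra_simps)
  qed
  moreover have "l > 0"
    by (simp add: l_def pos)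
  ultimately show thesis
    using that left by simp
qed

text \<open>The columns of \<open>J\<close> are the vectors that represent \<open>X 1, X 2, X 3\<close> at the identity.
  The structure constant \<open>c\<close> carries both the scale of the metric and the orientation of the
  frame.\<close>

locale left_frame =
  fixes m :: metric3 and X :: "3 \<Rightarrow> vfield" and J J' :: mat3 and c :: real
  assumes frame_value: "p \<in> SO3 \<Longrightarrow> X i p = p ** hat (J *v axis i 1)"
    and metric_inner: "p \<in> SO3 \<Longrightarrow> m p (p ** hat (J *v v)) (p ** hat (J *v w)) = v \<bullet> w"
    and J_inverse: "J ** J' = mat 1"
    and J_cross: "(J *v v) \<times> (J *v w) = c *\<^sub>R (J *v (v \<times> w))"

text \<open>If the metric is \<open>l\<close> times the Euclidean one, then \<open>sqrt l *\<^sub>R J\<close> is an orthogonal matrix. It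
  maps cross products to cross products up to the sign of its determinant, which determines
  \<open>c\<close>.\<close>

lemma orthonormal_basis_left_frame:
  assumes "bi_invariant_metric m" "orthonormal_basis m X"
  obtains J J' c where "left_frame m X J J' c"
proof -
  obtain l where l: "l > 0"
    "\<And>p u v. p \<in> SO3 \<Longrightarrow> m p (p ** hat u) (p ** hat v) = l * (u \<bullet> v)"
    using bi_invariant_metric_scalar[OF assms(1)] by blast
  define e where "e i = vee (X i (mat 1))" for i
  have X: "X i p = p ** hat (e i)" if "p \<in> SO3" for i p
    using assms(2) that left_invariant_value unfolding orthonormal_basis_def e_def by blast
  have e: "l * (e i \<bullet> e j) = (if i = j then 1 else 0)" for i j
    using assms(2) mat_1_in_SO3 l(2)[OF mat_1_in_SO3] X[OF mat_1_in_SO3]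
    unfolding orthonormal_basis_def by metis
  define J :: mat3 where "J = transpose (\<chi> i. e i)"
  have J: "J *v axis i 1 = e i" for i
    by (simp add: J_def matrix_vector_mult_basis column_transpose row_def vec_eq_iff)
  have JJ: "transpose J ** (l *\<^sub>R J) = mat 1"
    using e by (simp add: J_def vec_eq_iff matrix_matrix_mult_def transpose_def mat_def inner_vec_def
        sum_distrib_left mult.left_commute)
  have iso: "l * ((J *v v) \<bullet> (J *v w)) = v \<bullet> w" for v w
  proof -
    have "l * ((J *v v) \<bullet> (J *v w)) = v \<bullet> (transpose J *v ((l *\<^sub>R J) *v w))"
      using dot_lmul_matrix[of v "transpose J" "(l *\<^sub>R J) *v w"]
      by (simp add: scaleR_matrix_vector_assoc[symmetric])
    then show ?thesis by (simp add: matrix_vector_mul_assoc JJ)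
  qed
  define Q where "Q = sqrt l *\<^sub>R J"
  have Q: "orthogonal_matrix Q"
    using JJ l(1) unfolding orthogonal_matrix Q_def
    by (simp add: transpose_scalar scalar_matrix_assoc[symmetric] matrix_scalar_ac)
  have "l *\<^sub>R ((J *v v) \<times> (J *v w)) = (det Q * sqrt l) *\<^sub>R (J *v (v \<times> w))" for v w
    using cross_orthogonal_matrix[OF Q, of v w] l(1)
    by (simp add: Q_def cross_mult_left cross_mult_right flip: scaleR_matrix_vector_assoc)
  then have "(J *v v) \<times> (J *v w) = (det Q * sqrt l / l) *\<^sub>R (J *v (v \<times> w))" for v w
    using l(1) by (metis (no_types, lifting) divide_inverse_commute less_irrefl scaleR_scaleR vector_fraction_eq_iff
       scaleR_one left_inverse)
  moreover have JJ': "(l *\<^sub>R transpose J) ** J = mat 1"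
    using JJ by (simp add: matrix_scalar_ac scalar_matrix_assoc)
  ultimately have "left_frame m X J (l *\<^sub>R transpose J) (det Q * sqrt l / l)"
    using X J l iso matrix_left_right_inverse[of "l *\<^sub>R transpose J" J]
    by unfold_locales simp_all
  then show thesis using that by blast
qed

context left_frame
begin

text \<open>The vector \<open>v\<close> consists of the coordinates of the field in the frame \<open>X 1, X 2, X 3\<close>.\<close>

definition left_field :: "real ^ 3 \<Rightarrow> vfield" where
  "left_field v p = p ** hat (J *v v)"

lemma linear_left_field: "linear (\<lambda>v. left_field v p)"
  unfolding left_field_def
  by (rule linearI) (simp_all add: matrix_vector_right_distrib matrix_vector_mult_scaleR
     linear_add[OF linear_hat] linear_scale[OF linear_hat] matrix_add_ldistrib matrix_scalar_ac
     scalar_matrix_assoc)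

lemma left_field_sum:
  assumes "p \<in> SO3"
  shows "(\<Sum>i\<in>UNIV. v i *\<^sub>R X i p) = left_field (\<chi> i. v i) p"
proof -
  have "(\<chi> i. v i) = (\<Sum>i\<in>UNIV. v i *\<^sub>R axis i 1)"
    by (simp add: vec_eq_iff axis_def if_distrib cong: if_cong)
  then show ?thesis
    using assms by (simp add: frame_value left_field_def[symmetric] linear_sum[OF linear_left_field] linear_scale[OF linear_left_field])
qed

lemma metric_left_field: "p \<in> SO3 \<Longrightarrow> m p (left_field v p) (left_field w p) = v \<bullet> w"
  by (simp add: left_field_def metric_inner)

lemma left_field_eq_iff:
  assumes "p \<in> SO3"
  shows "left_field v p = left_field w p \<longleftrightarrow> v = w"
proof
  assume "left_field v p = left_field w p"
  then have "left_field (v - w) p = 0"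
    by (simp add: linear_diff[OF linear_left_field])
  then have "m p (left_field (v - w) p) (left_field (v - w) p) = m p (left_field 0 p) (left_field 0 p)"
    by (simp add: linear_0[OF linear_left_field])
  then show "v = w"
    using assms by (simp add: metric_left_field)
qed simp

text \<open>The coordinates of a tangent vector are obtained linearly from its matrix. Reading them off
  with the metric instead would not show that they are smooth along a curve, because a bi-invariant
  metric is constrained only on tangent vectors.\<close>

lemma tangent_left_field:
  assumes "p \<in> SO3" "u \<in> tangent_SO3 p"
  shows "u = left_field (J' *v vee (transpose p ** u)) p"
proof -
  obtain v where v: "u = p ** hat v" using assms(2) tangent_SO3_iff by blast
  then have "transpose p ** u = hat v"
    using SO3_orthogonal(1)[OF assms(1)] by (simp add: matrix_mul_assoc)
  then show ?thesis
    by (simp add: v left_field_def vee_hat matrix_vector_mul_assoc J_inverse)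
qed

lemma coeff_left_field:
  assumes "\<alpha> s \<in> SO3" "W s = left_field w (\<alpha> s)"
  shows "coeff m X \<alpha> W i s = w $ i"
  using assms by (simp add: coeff_def frame_value left_field_def[symmetric] metric_left_field inner_axis)

section \<open>Vector fields along a curve in coordinates\<close>

lemma lie_bracket_frame:
  assumes "p \<in> SO3"
  shows "lie_bracket (X i) (X j) p = c *\<^sub>R left_field (axis i 1 \<times> axis j 1) p"
  by (simp add: lie_bracket_def frame_value mat_1_in_SO3 hat_cross J_cross left_field_def
      linear_scale[OF linear_hat] matrix_scalar_ac scalar_matrix_assoc)

lemma bracket_along_left_field:
  assumes "\<alpha> s \<in> SO3" "V s = left_field v (\<alpha> s)" "W s = left_field w (\<alpha> s)"
  shows "bracket_along m X \<alpha> V W s = c *\<^sub>R left_field (v \<times> w) (\<alpha> s)"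
proof -
  have "v \<times> w = (\<Sum>i\<in>UNIV. v $ i *\<^sub>R axis i 1) \<times> (\<Sum>j\<in>UNIV. w $ j *\<^sub>R axis j 1)"
    by (simp only: basis_expansion flip: scalar_mult_eq_scaleR)
  also have "\<dots> = (\<Sum>i\<in>UNIV. \<Sum>j\<in>UNIV. (v $ i * w $ j) *\<^sub>R (axis i 1 \<times> axis j 1))"
    by (simp add: bilinear_sum[OF bilinear_cross] sum.cartesian_product cross_mult_left cross_mult_right
        mult.commute)
  finally have vw: "v \<times> w = \<dots>" .
  show ?thesis
    unfolding bracket_along_def vw
    by (simp add: coeff_left_field[of \<alpha> s V v] coeff_left_field[of \<alpha> s W w] assms lie_bracket_frame
        linear_sum[OF linear_left_field] linear_scale[OF linear_left_field] scaleR_sum_right mult.commute)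
qed

lemma cross_along_left_field:
  assumes "\<alpha> s \<in> SO3" "V s = left_field v (\<alpha> s)" "W s = left_field w (\<alpha> s)"
  shows "cross_along m X \<alpha> V W s = left_field (v \<times> w) (\<alpha> s)"
  using assms
  by (simp add: cross_along_def left_field_sum coeff_left_field[of \<alpha> s V v] coeff_left_field[of \<alpha> s W w])

lemma dot_along_left_field:
  assumes I: "open I" "s \<in> I" and \<alpha>: "\<And>r. r \<in> I \<Longrightarrow> \<alpha> r \<in> SO3"
    and W: "\<And>r. r \<in> I \<Longrightarrow> W r = left_field (w r) (\<alpha> r)"
    and w: "(w has_vector_derivative w') (at s)"
  shows "dot_along m X \<alpha> W s = left_field w' (\<alpha> s)"
proof -
  have "deriv (coeff m X \<alpha> W i) s = w' $ i" for i
  proof -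
    have "((\<lambda>r. w r $ i) has_real_derivative w' $ i) (at s)"
      using bounded_linear.has_vector_derivative[OF bounded_linear_vec_nth w]
      by (simp add: has_real_derivative_iff_has_vector_derivative)
    then have "(coeff m X \<alpha> W i has_real_derivative w' $ i) (at s)"
      using assms coeff_left_field
      by (elim has_field_derivative_transform_within_open[where S = I]) auto
    then show ?thesis by (rule DERIV_imp_deriv)
  qed
  then show ?thesis
    using \<alpha>[OF I(2)] by (simp add: dot_along_def left_field_sum)
qed

end


section \<open>Slant helices in Euclidean three-space\<close>

lemma has_real_derivative_inner_left:
  fixes f :: "real \<Rightarrow> 'a::real_inner"
  shows "(f has_vector_derivative f') (at s) \<Longrightarrow> ((\<lambda>r. f r \<bullet> x) has_real_derivative f' \<bullet> x) (at s)"
  using bounded_linear.has_vector_derivative[OF bounded_linear_inner_left]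
  by (simp add: has_real_derivative_iff_has_vector_derivative)

text \<open>The Frenet equations of a space curve with curvature \<open>k\<close> and torsion \<open>u\<close>. That \<open>u / k\<close> is
  differentiable has to be required separately: where it is not, the term \<open>deriv\<close> says nothing.\<close>

locale moving_frame =
  fixes I :: "real set" and t n b :: "real \<Rightarrow> real ^ 3" and k u :: "real \<Rightarrow> real"
  assumes open_I: "open I" and interval_I: "is_interval I"
    and deriv_t: "s \<in> I \<Longrightarrow> (t has_vector_derivative k s *\<^sub>R n s) (at s)"
    and deriv_n: "s \<in> I \<Longrightarrow> (n has_vector_derivative u s *\<^sub>R b s - k s *\<^sub>R t s) (at s)"
    and deriv_b: "s \<in> I \<Longrightarrow> (b has_vector_derivative - u s *\<^sub>R n s) (at s)"
    and n_unit: "s \<in> I \<Longrightarrow> n s \<bullet> n s = 1"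
    and n_orthogonal: "s \<in> I \<Longrightarrow> n s \<bullet> t s = 0" "s \<in> I \<Longrightarrow> n s \<bullet> b s = 0"
    and k_pos: "s \<in> I \<Longrightarrow> k s > 0"
    and ratio_differentiable: "s \<in> I \<Longrightarrow> (\<lambda>r. u r / k r) differentiable (at s)"
begin

definition h :: "real \<Rightarrow> real" where "h s = u s / k s"

text \<open>If the frame is orthonormal, then the speed of \<open>n\<close> is \<open>k w\<close>.\<close>

definition w :: "real \<Rightarrow> real" where "w s = sqrt (1 + (h s)\<^sup>2)"

lemma w_pos: "w s > 0"
  by (simp add: w_def add_pos_nonneg)

lemma w_square: "(w s)\<^sup>2 = 1 + (h s)\<^sup>2"
  by (simp add: w_def)

lemma deriv_h: "s \<in> I \<Longrightarrow> (h has_real_derivative deriv h s) (at s)"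
  using ratio_differentiable unfolding h_def[abs_def]
  by (simp add: DERIV_deriv_iff_real_differentiable)

lemma deriv_w: "s \<in> I \<Longrightarrow> (w has_real_derivative h s * deriv h s / w s) (at s)"
proof -
  assume s: "s \<in> I"
  have "((\<lambda>r. 1 + (h r)\<^sup>2) has_real_derivative 2 * h s * deriv h s) (at s)"
    by (rule derivative_eq_intros deriv_h[OF s] refl | simp)+
  moreover have "0 < 1 + (h s)\<^sup>2"
    by (simp add: add_pos_nonneg)
  ultimately show ?thesis
    using DERIV_chain2[OF DERIV_real_sqrt, of "\<lambda>r. 1 + (h r)\<^sup>2" s]
    by (fastforce simp: w_def[abs_def] field_simps)
qed

lemma u_eq: "s \<in> I \<Longrightarrow> u s = h s * k s"
  using k_pos[of s] by (simp add: h_def)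

lemma speed_powr:
  assumes "s \<in> I"
  shows "((k s)\<^sup>2 + (u s)\<^sup>2) powr (3/2) = (k s * w s) ^ 3"
proof -
  have pos: "k s * w s > 0"
    using k_pos[OF assms] w_pos by simp
  have "(k s)\<^sup>2 + (u s)\<^sup>2 = (k s * w s)\<^sup>2"
    by (simp add: u_eq[OF assms] power_mult_distrib w_square algebra_simps)
  also have "\<dots> = (k s * w s) powr 2"
    using pos by simp
  finally have "((k s)\<^sup>2 + (u s)\<^sup>2) powr (3/2) = (k s * w s) powr 3"
    by (simp only: powr_powr) simp
  then show ?thesis
    using pos by (simp add: powr_numeral)
qed

text \<open>For an orthonormal frame this is, up to sign, the reciprocal of the geodesic curvature of the
  spherical image of \<open>n\<close>. That image lies on a circle exactly if \<open>n\<close> makes a constant angle with a fixed direction.\<close>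

definition \<sigma> :: "real \<Rightarrow> real" where
  "\<sigma> s = ((k s)\<^sup>2 + (u s)\<^sup>2) powr (3/2) / ((k s)\<^sup>2 * deriv h s)"

lemma \<sigma>_eq: "s \<in> I \<Longrightarrow> \<sigma> s = k s * w s ^ 3 / deriv h s"
  using k_pos[of s] unfolding \<sigma>_def by (subst speed_powr) (simp_all add: power2_eq_square power3_eq_cube)

text \<open>From \<open>n \<bullet> x = c\<close> follows \<open>t \<bullet> x = h (b \<bullet> x)\<close>, and differentiating once more gives
  \<open>h' (b \<bullet> x) = c k w\<^sup>2\<close>. So \<open>h'\<close> has no zero, and \<open>\<sigma> = (b \<bullet> x) w / c\<close>, where the numerator is
  constant because its derivative vanishes.\<close>

lemma constant_angle_imp_\<sigma>_constant:
  assumes c: "c \<noteq> 0" and nx: "\<And>s. s \<in> I \<Longrightarrow> n s \<bullet> x = c"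
  shows "(\<forall>s\<in>I. deriv h s \<noteq> 0) \<and> \<sigma> constant_on I"
proof -
  have dt: "((\<lambda>r. t r \<bullet> x) has_real_derivative k s * c) (at s)" if "s \<in> I" for s
    using has_real_derivative_inner_left[OF deriv_t[OF that], of x] nx[OF that] by simp
  have db: "((\<lambda>r. b r \<bullet> x) has_real_derivative - u s * c) (at s)" if "s \<in> I" for s
    using has_real_derivative_inner_left[OF deriv_b[OF that], of x] nx[OF that] by simp
  have tx: "t s \<bullet> x = h s * (b s \<bullet> x)" if "s \<in> I" for s
  proof -
    have "((\<lambda>r. n r \<bullet> x) has_real_derivative 0) (at s)"
      by (rule has_field_derivative_transform_within_open[OF DERIV_const[of c] open_I that])
        (simp add: nx)
    moreover have "((\<lambda>r. n r \<bullet> x) has_real_derivative u s * (b s \<bullet> x) - k s * (t s \<bullet> x)) (at s)"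
      using has_real_derivative_inner_left[OF deriv_n[OF that], of x] by (simp add: inner_diff_left)
    ultimately have "u s * (b s \<bullet> x) - k s * (t s \<bullet> x) = 0"
      by (rule DERIV_unique[symmetric])
    then show ?thesis
      using k_pos[OF that] by (simp add: h_def field_simps)
  qed
  have key: "deriv h s * (b s \<bullet> x) = c * k s * (w s)\<^sup>2" if "s \<in> I" for s
  proof -
    have "((\<lambda>r. h r * (b r \<bullet> x)) has_real_derivative k s * c) (at s)"
      using has_field_derivative_transform_within_open[OF dt[OF that] open_I that] tx by auto
    moreover have "((\<lambda>r. h r * (b r \<bullet> x)) has_real_derivative
        deriv h s * (b s \<bullet> x) + (- u s * c) * h s) (at s)"
      by (rule DERIV_mult[OF deriv_h[OF that] db[OF that]])
    ultimately have "k s * c = deriv h s * (b s \<bullet> x) + (- u s * c) * h s"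
      by (rule DERIV_unique)
    then show ?thesis
      unfolding w_square by (simp add: u_eq[OF that] algebra_simps power2_eq_square)
  qed
  have nz: "deriv h s \<noteq> 0" if "s \<in> I" for s
    using key[OF that] c k_pos[OF that] w_pos[of s] by auto
  have "((\<lambda>r. (b r \<bullet> x) * w r) has_real_derivative 0) (at s)" if "s \<in> I" for s
  proof -
    have "(b s \<bullet> x) * (h s * deriv h s / w s) = h s * (deriv h s * (b s \<bullet> x)) / w s"
      by simp
    also have "\<dots> = u s * c * w s"
      using w_pos[of s] by (simp add: key[OF that] u_eq[OF that] power2_eq_square)
    finally show ?thesis
      using DERIV_mult[OF db[OF that] deriv_w[OF that]] by (simp add: mult.commute)
  qed
  then have "\<exists>q. \<forall>s\<in>I. (b s \<bullet> x) * w s = q"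
    using interval_I by (intro has_field_derivative_zero_constant)
      (auto simp: is_interval_convex_1 intro: has_field_derivative_at_within)
  then obtain q where q: "\<And>s. s \<in> I \<Longrightarrow> (b s \<bullet> x) * w s = q"
    by blast
  have "\<sigma> s = q / c" if "s \<in> I" for s
  proof -
    have "c * (k s * w s ^ 3) = deriv h s * q"
      using key[OF that] q[OF that, symmetric] by (simp add: power3_eq_cube power2_eq_square)
    then show ?thesis
      using nz[OF that] c by (simp add: \<sigma>_eq[OF that] field_simps)
  qed
  then show ?thesis
    using nz unfolding constant_on_def by blast
qed

text \<open>The axis is sought as a vector along the curve with \<open>n\<close>-component \<open>1\<close>. By the computation in the
  converse direction its other components must be \<open>b \<bullet> v = \<sigma> / w\<close> and \<open>t \<bullet> v = h (b \<bullet> v)\<close>. With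
  \<open>\<sigma>\<close> constant, \<open>\<sigma> h' = k w\<^sup>3\<close> makes the derivative of \<open>v\<close> vanish.\<close>

lemma \<sigma>_constant_imp_constant_angle:
  assumes nonempty: "I \<noteq> {}" and nz: "\<And>s. s \<in> I \<Longrightarrow> deriv h s \<noteq> 0" and const: "\<sigma> constant_on I"
  obtains x c where "norm x = 1" "c \<noteq> 0" "\<And>s. s \<in> I \<Longrightarrow> n s \<bullet> x = c"
proof -
  obtain q where q: "\<And>s. s \<in> I \<Longrightarrow> \<sigma> s = q"
    using const unfolding constant_on_def by blast
  have key: "q * deriv h s = k s * w s ^ 3" if "s \<in> I" for s
    using q[OF that] nz[OF that] by (simp add: \<sigma>_eq[OF that] field_simps)
  define v where "v s = (h s * (q / w s)) *\<^sub>R t s + n s + (q / w s) *\<^sub>R b s" for s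
  have "(v has_vector_derivative 0) (at s)" if s: "s \<in> I" for s
  proof -
    have w: "w s \<noteq> 0" using w_pos[of s] by simp
    have db: "((\<lambda>r. q / w r) has_real_derivative - u s) (at s)"
    proof -
      have "- (q * (h s * deriv h s / w s)) / (w s)\<^sup>2 = - (q * deriv h s) * h s / w s ^ 3"
        using w by (simp add: field_simps power3_eq_cube power2_eq_square)
      also have "\<dots> = - u s"
        using w by (simp add: key[OF s] u_eq[OF s])
      finally show ?thesis
        using DERIV_divide[OF DERIV_const[of q] deriv_w[OF s] w] by (simp add: power2_eq_square)
    qed
    have dt: "((\<lambda>r. h r * (q / w r)) has_real_derivative k s) (at s)"
    proof -
      have "deriv h s * (q / w s) = (q * deriv h s) / w s"
        by simp
      also have "\<dots> = k s * (w s)\<^sup>2"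
        using w by (simp add: key[OF s] power3_eq_cube power2_eq_square)
      finally have "deriv h s * (q / w s) + (- u s) * h s = k s"
        unfolding w_square by (simp add: u_eq[OF s] algebra_simps power2_eq_square)
      then show ?thesis
        using DERIV_mult[OF deriv_h[OF s] db] by simp
    qed
    have "(v has_vector_derivative
        ((h s * (q / w s)) *\<^sub>R (k s *\<^sub>R n s) + k s *\<^sub>R t s) + (u s *\<^sub>R b s - k s *\<^sub>R t s) +
        ((q / w s) *\<^sub>R (- u s *\<^sub>R n s) + (- u s) *\<^sub>R b s)) (at s)"
      unfolding v_def[abs_def]
      by (intro has_vector_derivative_add has_vector_derivative_scaleR dt db deriv_t deriv_n deriv_b s)
    moreover have "((h s * (q / w s)) *\<^sub>R (k s *\<^sub>R n s) + k s *\<^sub>R t s) + (u s *\<^sub>R b s - k s *\<^sub>R t s) +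
        ((q / w s) *\<^sub>R (- u s *\<^sub>R n s) + (- u s) *\<^sub>R b s) = 0"
      by (simp add: u_eq[OF s] algebra_simps)
    ultimately show ?thesis by (simp only:)
  qed
  then have "\<exists>y. \<forall>s\<in>I. v s = y"
    using interval_I
    by (intro has_derivative_zero_constant)
      (auto simp: is_interval_convex_1 has_vector_derivative_def intro: has_derivative_at_withinI)
  then obtain y where y: "\<And>s. s \<in> I \<Longrightarrow> v s = y"
    by blast
  have ny: "n s \<bullet> y = 1" if "s \<in> I" for s
    using n_unit[OF that] n_orthogonal[OF that]
    by (simp add: y[OF that, symmetric] v_def inner_add_right)
  have "y \<noteq> 0"
    using nonempty ny by fastforce
  then show thesis
    using that[of "y /\<^sub>R norm y" "1 / norm y"] ny by (simp add: divide_inverse)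
qed

end


section \<open>Smoothness of the coordinates of the velocity\<close>

lemma bounded_bilinear_transpose_mult:
  "bounded_bilinear (\<lambda>P Q :: mat3. transpose P ** Q)"
  unfolding bilinear_conv_bounded_bilinear[symmetric] bilinear_def
  by (auto intro!: linearI simp: vec_eq_iff matrix_matrix_mult_def transpose_def sum_3 algebra_simps)

text \<open>Differentiate \<open>transpose (\<alpha> r) ** \<alpha> r = mat 1\<close>.\<close>

lemma transpose_velocity_skew:
  assumes "open I" "s \<in> I" "\<And>r. r \<in> I \<Longrightarrow> \<alpha> r \<in> SO3" "(\<alpha> has_vector_derivative v) (at s)"
  shows "transpose (transpose (\<alpha> s) ** v) = - (transpose (\<alpha> s) ** v)"
proof -
  have "((\<lambda>r. transpose (\<alpha> r) ** \<alpha> r) has_vector_derivative transpose (\<alpha> s) ** v + transpose v ** \<alpha> s) (at s)"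
    by (rule bounded_bilinear.has_vector_derivative[OF bounded_bilinear_transpose_mult assms(4,4)])
  moreover have "((\<lambda>r. transpose (\<alpha> r) ** \<alpha> r) has_vector_derivative 0) (at s)"
    by (rule has_vector_derivative_transform_within_open[OF has_vector_derivative_const[of "mat 1"] assms(1,2)])
      (simp add: SO3_orthogonal assms(3))
  ultimately have "transpose (\<alpha> s) ** v + transpose v ** \<alpha> s = 0"
    by (rule vector_derivative_unique_at)
  then show ?thesis
    by (simp add: matrix_transpose_mul eq_neg_iff_add_eq_0 add.commute)
qed

text \<open>Three derivatives of the tangent coordinates suffice, since \<open>h'\<close> involves no derivative of the
  tangent beyond the third. Counting derivatives makes closure under bilinear maps a plain
  induction.\<close>

primrec times_differentiable :: "nat \<Rightarrow> real set \<Rightarrow> (real \<Rightarrow> 'a::real_normed_vector) \<Rightarrow> bool" where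
  "times_differentiable 0 I f \<longleftrightarrow> True"
| "times_differentiable (Suc j) I f \<longleftrightarrow>
     (\<exists>f'. (\<forall>s\<in>I. (f has_vector_derivative f' s) (at s)) \<and> times_differentiable j I f')"

lemma times_differentiable_add:
  "times_differentiable j I f \<Longrightarrow> times_differentiable j I g \<Longrightarrow> times_differentiable j I (\<lambda>s. f s + g s)"
proof (induction j arbitrary: f g)
  case (Suc j)
  then obtain f' g' where "\<forall>s\<in>I. (f has_vector_derivative f' s) (at s)" "times_differentiable j I f'"
    "\<forall>s\<in>I. (g has_vector_derivative g' s) (at s)" "times_differentiable j I g'"
    by auto
  then show ?case
    using Suc.IH by (auto intro!: exI[of _ "\<lambda>s. f' s + g' s"] has_vector_derivative_add)
qed simp

lemma times_differentiable_Suc_imp: "times_differentiable (Suc j) I f \<Longrightarrow> times_differentiable j I f"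
  by (induction j arbitrary: f) fastforce+

lemma times_differentiable_bilinear:
  assumes "bounded_bilinear p"
  shows "times_differentiable j I f \<Longrightarrow> times_differentiable j I g \<Longrightarrow> times_differentiable j I (\<lambda>s. p (f s) (g s))"
proof (induction j arbitrary: f g)
  case (Suc j)
  then obtain f' g' where d: "\<forall>s\<in>I. (f has_vector_derivative f' s) (at s)" "times_differentiable j I f'"
    "\<forall>s\<in>I. (g has_vector_derivative g' s) (at s)" "times_differentiable j I g'"
    by auto
  have "times_differentiable j I (\<lambda>s. p (f s) (g' s) + p (f' s) (g s))"
    using Suc.prems[THEN times_differentiable_Suc_imp] d
    by (intro times_differentiable_add Suc.IH)
  then show ?case
    using d bounded_bilinear.has_vector_derivative[OF assms]
    by (auto intro!: exI[of _ "\<lambda>s. p (f s) (g' s) + p (f' s) (g s)"])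
qed simp

lemma times_differentiable_linear:
  assumes "bounded_linear p"
  shows "times_differentiable j I f \<Longrightarrow> times_differentiable j I (\<lambda>s. p (f s))"
proof (induction j arbitrary: f)
  case (Suc j)
  then obtain f' where "\<forall>s\<in>I. (f has_vector_derivative f' s) (at s)" "times_differentiable j I f'"
    by auto
  then show ?case
    using Suc.IH bounded_linear.has_vector_derivative[OF assms] by (auto intro!: exI[of _ "\<lambda>s. p (f' s)"])
qed simp

lemma smooth_chain_times_differentiable:
  assumes "\<And>i s. s \<in> I \<Longrightarrow> (F i has_vector_derivative F (Suc i) s) (at s)"
  shows "times_differentiable j I (F i)"
  using assms by (induction j arbitrary: i) auto

section \<open>From Frenet curves to Euclidean moving frames\<close>

context left_frame
begin

lemma velocity_coordinates:
  assumes "unit_speed_curve m I \<alpha>"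
  obtains t where "times_differentiable j I t"
    "\<And>s. s \<in> I \<Longrightarrow> velocity \<alpha> s = left_field (t s) (\<alpha> s)"
proof -
  have I: "open I" and \<alpha>: "\<And>s. s \<in> I \<Longrightarrow> \<alpha> s \<in> SO3"
    using assms by (auto simp: unit_speed_curve_def)
  obtain F where F: "F 0 = \<alpha>" "\<And>i s. s \<in> I \<Longrightarrow> (F i has_vector_derivative F (Suc i) s) (at s)"
    using assms unfolding unit_speed_curve_def smooth_curve_on_def by metis
  define L where "L A = J' *v vee A" for A
  have "linear L"
    unfolding L_def using linear_compose[OF linear_vee matrix_vector_mul_linear] by (simp add: o_def)
  then have L: "bounded_linear L"
    by (simp add: linear_conv_bounded_linear)
  define t where "t s = L (transpose (F 0 s) ** F 1 s)" for s
  have "times_differentiable j I t"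
    unfolding t_def using smooth_chain_times_differentiable[of I F] F(2)
    by (intro times_differentiable_linear[OF L] times_differentiable_bilinear[OF bounded_bilinear_transpose_mult]) auto
  moreover have "velocity \<alpha> s = left_field (t s) (\<alpha> s)" if s: "s \<in> I" for s
  proof -
    have d: "(\<alpha> has_vector_derivative F 1 s) (at s)"
      using F(2)[OF s, of 0] F(1) by simp
    have "F 1 s = \<alpha> s ** (transpose (\<alpha> s) ** F 1 s)"
      using SO3_orthogonal(2)[OF \<alpha>[OF s]] by (simp add: matrix_mul_assoc)
    then have "F 1 s \<in> tangent_SO3 (\<alpha> s)"
      using transpose_velocity_skew[OF I s \<alpha> d] unfolding tangent_SO3_def by blast
    then have "F 1 s = left_field (t s) (\<alpha> s)"
      using tangent_left_field[OF \<alpha>[OF s]] by (simp add: t_def L_def F(1))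
    then show ?thesis
      using vector_derivative_at[OF d] by (simp add: velocity_def)
  qed
  ultimately show thesis using that by blast
qed

text \<open>For \<open>c = 1\<close> this is differentiation of the coordinates plus half the cross product with the
  tangent. For \<open>w = n\<close> the correction is \<open>b / 2\<close>, and this is the shift of the torsion by
  \<open>1/2\<close>.\<close>

lemma cov_deriv_left_field:
  assumes I: "open I" "s \<in> I" and \<alpha>: "\<And>r. r \<in> I \<Longrightarrow> \<alpha> r \<in> SO3"
    and v: "velocity \<alpha> s = left_field v (\<alpha> s)"
    and W: "\<And>r. r \<in> I \<Longrightarrow> W r = left_field (w r) (\<alpha> r)"
    and w: "(w has_vector_derivative w') (at s)"
  shows "cov_deriv m X \<alpha> W s = left_field (w' + (c / 2) *\<^sub>R (v \<times> w s)) (\<alpha> s)"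
  using dot_along_left_field[OF I \<alpha> W w]
    bracket_along_left_field[of \<alpha> s "velocity \<alpha>" v W "w s"] assms
  by (simp add: cov_deriv_def linear_add[OF linear_left_field] linear_scale[OF linear_left_field])

text \<open>The vectors \<open>t\<close>, \<open>n\<close>, \<open>b\<close> are the coordinates of \<open>T\<close>, \<open>N\<close>, \<open>B\<close>. The Frenet data come without
  regularity, so differentiability of \<open>n\<close>, \<open>\<kappa>\<close> and \<open>\<tau>\<close> is derived from that of \<open>t\<close>: \<open>\<kappa>\<close> is the
  norm of \<open>t'\<close>, which has no zero, \<open>n\<close> is \<open>t' / \<kappa>\<close>, and the torsion is expressed by
  \<open>t'' \<bullet> b = \<kappa> (\<tau> - 1/2)\<close>.\<close>

lemma frenet_curve_moving_frame:
  assumes norm: "tau_G_normalized m X" and frenet: "frenet_curve m X I \<alpha> T N B \<kappa> \<tau>"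
  obtains t n b where "moving_frame I t n b \<kappa> (\<lambda>s. \<tau> s - 1/2)"
    "\<And>s. s \<in> I \<Longrightarrow> N s = left_field (n s) (\<alpha> s)"
proof -
  have curve: "unit_speed_curve m I \<alpha>"
    using frenet by (simp add: frenet_curve_def)
  then have I: "open I" "is_interval I" "I \<noteq> {}" and \<alpha>: "\<And>s. s \<in> I \<Longrightarrow> \<alpha> s \<in> SO3"
    by (auto simp: unit_speed_curve_def)
  have f: "T s = velocity \<alpha> s" "m (\<alpha> s) (T s) (N s) = 0" "m (\<alpha> s) (N s) (N s) = 1"
    "B s = cross_along m X \<alpha> T N s"
    "\<kappa> s = sqrt (m (\<alpha> s) (dot_along m X \<alpha> T s) (dot_along m X \<alpha> T s))" "\<kappa> s > 0"
    "cov_deriv m X \<alpha> T s = \<kappa> s *\<^sub>R N s"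
    "cov_deriv m X \<alpha> N s = - \<kappa> s *\<^sub>R T s + \<tau> s *\<^sub>R B s" if "s \<in> I" for s
    using frenet that unfolding frenet_curve_def by blast+
  obtain t where "times_differentiable 3 I t"
    and v: "\<And>s. s \<in> I \<Longrightarrow> velocity \<alpha> s = left_field (t s) (\<alpha> s)"
    using velocity_coordinates[OF curve] by blast
  then obtain t1 t2 t3 where t1: "\<And>s. s \<in> I \<Longrightarrow> (t has_vector_derivative t1 s) (at s)"
    and t2: "\<And>s. s \<in> I \<Longrightarrow> (t1 has_vector_derivative t2 s) (at s)"
    and t3: "\<And>s. s \<in> I \<Longrightarrow> (t2 has_vector_derivative t3 s) (at s)"
    unfolding numeral_3_eq_3 times_differentiable.simps by blast
  note lin = linear_add[OF linear_left_field] linear_diff[OF linear_left_field] linear_scale[OF linear_left_field]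
  have T: "T s = left_field (t s) (\<alpha> s)" if "s \<in> I" for s
    using f(1)[OF that] v[OF that] by simp
  have \<kappa>: "\<kappa> s = norm (t1 s)" if "s \<in> I" for s
    using f(5)[OF that] dot_along_left_field[OF I(1) that \<alpha> T t1[OF that]]
      metric_left_field[OF \<alpha>[OF that]]
    by (simp add: norm_eq_sqrt_inner)
  define n where "n s = (1 / \<kappa> s) *\<^sub>R t1 s" for s
  have t1n: "t1 s = \<kappa> s *\<^sub>R n s" if "s \<in> I" for s
    using f(6)[OF that] by (simp add: n_def)
  have N: "N s = left_field (n s) (\<alpha> s)" if "s \<in> I" for s
  proof -
    have "\<kappa> s *\<^sub>R N s = left_field (t1 s) (\<alpha> s)"
      using f(7)[OF that] cov_deriv_left_field[OF I(1) that \<alpha> v[OF that] T t1[OF that]] by simp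
    then show ?thesis
      using f(6)[OF that] by (simp add: t1n[OF that] lin)
  qed
  define b where "b s = t s \<times> n s" for s
  have B: "B s = left_field (b s) (\<alpha> s)" if "s \<in> I" for s
    using f(4)[OF that] cross_along_left_field[of \<alpha> s T "t s" N "n s"] \<alpha>[OF that] T[OF that] N[OF that]
    by (simp add: b_def)
  have ip: "t s \<bullet> t s = 1" "t s \<bullet> n s = 0" "n s \<bullet> n s = 1" if "s \<in> I" for s
  proof -
    have "m (\<alpha> s) (velocity \<alpha> s) (velocity \<alpha> s) = 1"
      using curve that by (simp add: unit_speed_curve_def)
    then show "t s \<bullet> t s = 1" "t s \<bullet> n s = 0" "n s \<bullet> n s = 1"
      using f(2,3)[OF that] v[OF that] T[OF that] N[OF that] by (simp_all add: metric_left_field \<alpha>[OF that])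
  qed
  have ib: "b s \<bullet> t s = 0" "b s \<bullet> n s = 0" "b s \<bullet> b s = 1" if "s \<in> I" for s
    using ip[OF that] by (simp_all add: b_def dot_cross_self inner_commute[of "t s \<times> n s"] dot_cross inner_commute[of "n s" "t s"])
  \<comment> \<open>The curve at hand is itself a Frenet curve, so the normalization can be tested on it:
    \<open>\<tau>\<^sub>G\<close> evaluates to \<open>c / 2\<close>.\<close>
  have c: "c = 1"
  proof -
    obtain s where s: "s \<in> I" using I(3) by blast
    have "tau_G m X \<alpha> T N B s = 1/2"
      using norm frenet s unfolding tau_G_normalized_def by blast
    moreover have "bracket_along m X \<alpha> T N s = left_field (c *\<^sub>R b s) (\<alpha> s)"
      using bracket_along_left_field[of \<alpha> s T "t s" N "n s"] \<alpha>[OF s] T[OF s] N[OF s]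
      by (simp add: b_def lin)
    ultimately show ?thesis
      by (simp add: tau_G_def B[OF s] metric_left_field[OF \<alpha>[OF s]] ib[OF s])
  qed
  have d\<kappa>: "(\<kappa> has_real_derivative (t1 s \<bullet> t2 s) / \<kappa> s) (at s)" if "s \<in> I" for s
  proof -
    have "t1 s \<noteq> 0" using f(6)[OF that] \<kappa>[OF that] by auto
    then have "((\<lambda>r. norm (t1 r)) has_derivative (\<lambda>x. (x *\<^sub>R t2 s) \<bullet> sgn (t1 s))) (at s)"
      using has_derivative_compose[OF t2[OF that, unfolded has_vector_derivative_def] has_derivative_norm] by simp
    moreover have "(\<lambda>x. (x *\<^sub>R t2 s) \<bullet> sgn (t1 s)) = (*) ((t1 s \<bullet> t2 s) / \<kappa> s)"
      by (rule ext) (simp add: sgn_div_norm \<kappa>[OF that] inner_commute divide_inverse)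
    ultimately have "((\<lambda>r. norm (t1 r)) has_real_derivative (t1 s \<bullet> t2 s) / \<kappa> s) (at s)"
      by (simp add: has_field_derivative_def)
    then show ?thesis
      by (rule has_field_derivative_transform_within_open[OF _ I(1) that]) (simp add: \<kappa>)
  qed
  have "\<exists>n'. (n has_vector_derivative n') (at s)" if "s \<in> I" for s
  proof -
    have "((\<lambda>r. 1 / \<kappa> r) has_real_derivative (0 * \<kappa> s - 1 * ((t1 s \<bullet> t2 s) / \<kappa> s)) / (\<kappa> s * \<kappa> s)) (at s)"
      using f(6)[OF that] by (intro DERIV_divide DERIV_const d\<kappa> that) simp
    from has_vector_derivative_scaleR[OF this t2[OF that]] show ?thesis
      unfolding n_def[abs_def] by blast
  qed
  then obtain n1 where n1: "\<And>s. s \<in> I \<Longrightarrow> (n has_vector_derivative n1 s) (at s)"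
    by metis
  have n1_eq: "n1 s = (\<tau> s - 1/2) *\<^sub>R b s - \<kappa> s *\<^sub>R t s" if "s \<in> I" for s
  proof -
    have "left_field (n1 s + (1/2) *\<^sub>R b s) (\<alpha> s) = left_field (\<tau> s *\<^sub>R b s - \<kappa> s *\<^sub>R t s) (\<alpha> s)"
      using f(8)[OF that] cov_deriv_left_field[OF I(1) that \<alpha> v[OF that] N n1[OF that]]
      by (simp add: c b_def[symmetric] T[OF that] B[OF that] lin)
    then have "n1 s + (1/2) *\<^sub>R b s = \<tau> s *\<^sub>R b s - \<kappa> s *\<^sub>R t s"
      by (simp only: left_field_eq_iff[OF \<alpha>[OF that]])
    then show ?thesis
      by (simp add: algebra_simps)
  qed
  have bc: "bounded_bilinear (\<times>)"
    using bilinear_cross by (simp add: bilinear_conv_bounded_bilinear)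
  have tb: "t s \<times> b s = - n s" if "s \<in> I" for s
    by (simp add: b_def Lagrange ip[OF that])
  have b1: "(b has_vector_derivative - (\<tau> s - 1/2) *\<^sub>R n s) (at s)" if "s \<in> I" for s
  proof -
    have "t s \<times> n1 s + t1 s \<times> n s = - (\<tau> s - 1/2) *\<^sub>R n s"
      by (simp add: n1_eq[OF that] t1n[OF that] cross_mult_left cross_mult_right
          Cross3.right_diff_distrib tb[OF that] scaleR_left_diff_distrib)
    then show ?thesis
      using bounded_bilinear.has_vector_derivative[OF bc t1[OF that] n1[OF that]]
      by (simp add: b_def[abs_def])
  qed
  have ratio: "(\<tau> s - 1/2) / \<kappa> s = (t2 s \<bullet> b s) / (\<kappa> s)\<^sup>2" if "s \<in> I" for s
  proof -
    have "((\<lambda>r. \<kappa> r *\<^sub>R n r) has_vector_derivative \<kappa> s *\<^sub>R n1 s + ((t1 s \<bullet> t2 s) / \<kappa> s) *\<^sub>R n s) (at s)"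
      by (rule has_vector_derivative_scaleR[OF d\<kappa>[OF that] n1[OF that]])
    then have "(t1 has_vector_derivative \<kappa> s *\<^sub>R n1 s + ((t1 s \<bullet> t2 s) / \<kappa> s) *\<^sub>R n s) (at s)"
      by (rule has_vector_derivative_transform_within_open[OF _ I(1) that]) (simp add: t1n)
    then have "t2 s = \<kappa> s *\<^sub>R n1 s + ((t1 s \<bullet> t2 s) / \<kappa> s) *\<^sub>R n s"
      by (rule vector_derivative_unique_at[OF t2[OF that]])
    from arg_cong[OF this, of "\<lambda>y. y \<bullet> b s"]
    have "t2 s \<bullet> b s = \<kappa> s * (n1 s \<bullet> b s) + ((t1 s \<bullet> t2 s) / \<kappa> s) * (n s \<bullet> b s)"
      by (simp only: inner_add_left inner_scaleR_left)
    also have "\<dots> = \<kappa> s * (\<tau> s - 1/2)"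
      using ib[OF that] by (simp add: n1_eq[OF that] inner_diff_left inner_commute[of "n s" "b s"] inner_commute[of "t s" "b s"])
    finally have "t2 s \<bullet> b s = \<kappa> s * (\<tau> s - 1/2)" .
    then show ?thesis
      using f(6)[OF that] by (simp add: power2_eq_square)
  qed
  have "(\<lambda>r. (\<tau> r - 1/2) / \<kappa> r) differentiable (at s)" if "s \<in> I" for s
  proof -
    have "((\<lambda>r. t2 r \<bullet> b r) has_real_derivative t2 s \<bullet> (- (\<tau> s - 1/2) *\<^sub>R n s) + t3 s \<bullet> b s) (at s)"
      using bounded_bilinear.has_vector_derivative[OF bounded_bilinear_inner t3[OF that] b1[OF that]]
      by (simp only: has_real_derivative_iff_has_vector_derivative)
    from DERIV_divide[OF this DERIV_power[OF d\<kappa>[OF that], of 2]] f(6)[OF that]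
    obtain d where "((\<lambda>r. (t2 r \<bullet> b r) / (\<kappa> r)\<^sup>2) has_real_derivative d) (at s)"
      by auto
    then have "((\<lambda>r. (\<tau> r - 1/2) / \<kappa> r) has_real_derivative d) (at s)"
      by (rule has_field_derivative_transform_within_open[OF _ I(1) that]) (simp add: ratio)
    then show ?thesis
      using real_differentiable_def by blast
  qed
  then have "moving_frame I t n b \<kappa> (\<lambda>s. \<tau> s - 1/2)"
    using I(1,2) t1 t1n n1 n1_eq b1 ip ib f(6)
    by unfold_locales (simp_all add: inner_commute)
  then show thesis using that N by blast
qed

text \<open>The angle \<open>\<theta>\<close> in \<open>{0..pi}\<close> corresponds to its cosine, and \<open>\<theta> \<noteq> pi/2\<close> says that the cosine is
  nonzero. Conversely the constant is a cosine by the Cauchy-Schwarz inequality.\<close>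

lemma slant_helix_iff_constant_inner:
  assumes "I \<noteq> {}" "\<And>s. s \<in> I \<Longrightarrow> \<alpha> s \<in> SO3" "\<And>s. s \<in> I \<Longrightarrow> N s = left_field (n s) (\<alpha> s)"
    and unit: "\<And>s. s \<in> I \<Longrightarrow> norm (n s) = 1"
  shows "slant_helix m I \<alpha> N \<longleftrightarrow> (\<exists>x a. norm x = 1 \<and> a \<noteq> 0 \<and> (\<forall>s\<in>I. n s \<bullet> x = a))"
proof
  assume "slant_helix m I \<alpha> N"
  then obtain Y \<theta> where Y: "left_invariant Y" "\<And>p. p \<in> SO3 \<Longrightarrow> m p (Y p) (Y p) = 1"
    and \<theta>: "\<theta> \<in> {0..pi}" "\<theta> \<noteq> pi/2" "\<And>s. s \<in> I \<Longrightarrow> m (\<alpha> s) (N s) (Y (\<alpha> s)) = cos \<theta>"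
    unfolding slant_helix_def by blast
  define x where "x = J' *v vee (Y (mat 1))"
  have Yx: "Y p = left_field x p" if "p \<in> SO3" for p
    using left_invariant_value[OF Y(1) that]
    by (simp add: left_field_def x_def matrix_vector_mul_assoc J_inverse)
  have "x \<bullet> x = 1"
    using Y(2)[OF mat_1_in_SO3] by (simp add: Yx mat_1_in_SO3 metric_left_field)
  moreover have "cos \<theta> \<noteq> 0"
    using \<theta>(1,2) arccos_cos[of \<theta>] arccos_0 by auto
  moreover have "\<forall>s\<in>I. n s \<bullet> x = cos \<theta>"
    using \<theta>(3) assms by (simp add: Yx metric_left_field)
  ultimately show "\<exists>x a. norm x = 1 \<and> a \<noteq> 0 \<and> (\<forall>s\<in>I. n s \<bullet> x = a)"
    by (metis norm_eq_1)
next
  assume "\<exists>x a. norm x = 1 \<and> a \<noteq> 0 \<and> (\<forall>s\<in>I. n s \<bullet> x = a)"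
  then obtain x a where x: "norm x = 1" "a \<noteq> 0" "\<And>s. s \<in> I \<Longrightarrow> n s \<bullet> x = a"
    by blast
  obtain s where "s \<in> I" using assms(1) by blast
  then have a: "\<bar>a\<bar> \<le> 1"
    using Cauchy_Schwarz_ineq2[of "n s" x] x unit by simp
  have "left_invariant (left_field x)"
    unfolding left_field_def[abs_def] by (rule left_invariant_translate)
  moreover have "\<forall>p\<in>SO3. m p (left_field x p) (left_field x p) = 1"
    using x(1) by (simp add: metric_left_field norm_eq_1)
  moreover have "arccos a \<in> {0..pi}"
    using a arccos_lbound[of a] arccos_ubound[of a] by auto
  moreover have "arccos a \<noteq> pi/2"
    using cos_arccos_abs[OF a] x(2) by (metis cos_pi_half)
  moreover have "\<forall>s\<in>I. m (\<alpha> s) (N s) (left_field x (\<alpha> s)) = cos (arccos a)"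
    using a x(3) assms(2,3) by (simp add: metric_left_field)
  ultimately show "slant_helix m I \<alpha> N"
    unfolding slant_helix_def by blast
qed

end

unbundle no cross3_syntax

section \<open>Characterization of slant helices\<close>

theorem corollary3p10:
  fixes m :: metric3 and X :: "3 \<Rightarrow> vfield" and I :: "real set"
    and \<alpha> T N B :: "real \<Rightarrow> mat3" and \<kappa> \<tau> :: "real \<Rightarrow> real"
  assumes "bi_invariant_metric m"
    and "orthonormal_basis m X"
    and "tau_G_normalized m X"
    and "frenet_curve m X I \<alpha> T N B \<kappa> \<tau>"
  shows "slant_helix m I \<alpha> N \<longleftrightarrow>
    (\<forall>s\<in>I. deriv (\<lambda>t. (\<tau> t - 1/2) / \<kappa> t) s \<noteq> 0) \<and> sigma_N \<kappa> \<tau> constant_on I"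
proof -
  obtain J J' c where "left_frame m X J J' c"
    using orthonormal_basis_left_frame[OF assms(1,2)] by blast
  then interpret left_frame m X J J' c .
  obtain t n b where frame: "moving_frame I t n b \<kappa> (\<lambda>s. \<tau> s - 1/2)"
    and N: "\<And>s. s \<in> I \<Longrightarrow> N s = left_field (n s) (\<alpha> s)"
    using frenet_curve_moving_frame[OF assms(3,4)] by blast
  interpret moving_frame I t n b \<kappa> "\<lambda>s. \<tau> s - 1/2"
    by (rule frame)
  have I: "I \<noteq> {}" "\<And>s. s \<in> I \<Longrightarrow> \<alpha> s \<in> SO3"
    using assms(4) by (auto simp: frenet_curve_def unit_speed_curve_def)
  have h: "h = (\<lambda>t. (\<tau> t - 1/2) / \<kappa> t)" and \<sigma>: "\<sigma> = sigma_N \<kappa> \<tau>"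
    by (simp_all add: fun_eq_iff h_def[abs_def] \<sigma>_def sigma_N_def)
  have "slant_helix m I \<alpha> N \<longleftrightarrow> (\<exists>x a. norm x = 1 \<and> a \<noteq> 0 \<and> (\<forall>s\<in>I. n s \<bullet> x = a))"
    using I N n_unit by (intro slant_helix_iff_constant_inner) (auto simp: norm_eq_1)
  also have "\<dots> \<longleftrightarrow> (\<forall>s\<in>I. deriv h s \<noteq> 0) \<and> \<sigma> constant_on I"
    using constant_angle_imp_\<sigma>_constant \<sigma>_constant_imp_constant_angle[OF I(1)] by metis
  finally show ?thesis
    unfolding h \<sigma> .
qed

end
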